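(* Let $f_0(x),f_1(x)\in\mathbb{C}[x]$ be nonzero polynomials with $\deg(f_0)>\deg(f_1)$, let $\{f_i(x)\}_{i=0}^{s+1}$ be their generalized Sturm sequence with quotients $B_i$, $m_i=\deg(B_i)$ and $b_i$ the leading coefficient of $B_i$ ($0\le i\le s-1$), and let $S_{f_0,f_1}(x)=x^{m_0-1}\overleftarrow{f_1}(x)/\overleftarrow{f_0}(x)$, regarded as a formal power series. Let $r$ be a positive integer. If $r=m_0+m_1+\cdots+m_{\kappa-1}$ for some $1\le\kappa\le s$, then $$H_r\big(S_{f_0,f_1}(x)\big)=(-1)^{\sum_{i=0}^{\kappa-1}\frac{m_i(m_i-1)}{2}}\cdot\frac{1}{\prod_{i=0}^{\kappa-2}b_i^{\,2\left(r-\sum_{j=0}^{i-1}m_j\right)-m_i}\cdot b_{\kappa-1}^{\,m_{\kappa-1}}}.$$ Otherwise, $H_r\big(S_{f_0,f_1}(x)\big)=0$.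
   Context: Generalized Sturm sequence: given nonzero $f_0,f_1\in\mathbb{C}[x]$ with $\deg(f_0)>\deg(f_1)$, define recursively $f_{i+2}=-\mathrm{rem}(f_i,f_{i+1})$ (minus the remainder of division of $f_i$ by $f_{i+1}$) as long as $f_{i+1}\neq0$; $s$ is the index with $f_s\neq0$, $f_{s+1}=0$. Quotients $B_i$ satisfy $f_i=B_if_{i+1}-f_{i+2}$ for $0\le i\le s-1$. Reversal: $\overleftarrow{f}(x)=x^{\deg f}f(x^{-1})$; note $\overleftarrow{f_0}$ has nonzero constant term, so $S_{f_0,f_1}$ is a power series. For a power series $F(x)=\sum_{i\ge0}h_ix^i$, the Hankel determinant of order $n$ is $H_n(F)=\det(h_{i+j})_{0\le i,j\le n-1}$, with $H_0(F)=1$. *)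

theory Defs
  imports
    Complex_Main
    "HOL-Computational_Algebra.Polynomial_FPS"
    "Jordan_Normal_Form.Determinant"
begin

text \<open>The generalized Sturm sequence, extended by \<open>0\<close> after its first zero entry. Without the test,
  the convention \<open>p mod 0 = p\<close> would produce further nonzero entries.\<close>

fun sturm :: "'a::field poly \<Rightarrow> 'a poly \<Rightarrow> nat \<Rightarrow> 'a poly" where
  "sturm f\<^sub>0 f\<^sub>1 0 = f\<^sub>0"
| "sturm f\<^sub>0 f\<^sub>1 (Suc 0) = f\<^sub>1"
| "sturm f\<^sub>0 f\<^sub>1 (Suc (Suc i)) =
     (if sturm f\<^sub>0 f\<^sub>1 (Suc i) = 0 then 0
      else - (sturm f\<^sub>0 f\<^sub>1 i mod sturm f\<^sub>0 f\<^sub>1 (Suc i)))"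

definition sturm_last :: "'a::field poly \<Rightarrow> 'a poly \<Rightarrow> nat" where
  "sturm_last f\<^sub>0 f\<^sub>1 = (THE s. sturm f\<^sub>0 f\<^sub>1 s \<noteq> 0 \<and> sturm f\<^sub>0 f\<^sub>1 (Suc s) = 0)"

definition sturm_quot :: "'a::field poly \<Rightarrow> 'a poly \<Rightarrow> nat \<Rightarrow> 'a poly" where
  "sturm_quot f\<^sub>0 f\<^sub>1 i = sturm f\<^sub>0 f\<^sub>1 i div sturm f\<^sub>0 f\<^sub>1 (Suc i)"

definition sturm_deg :: "'a::field poly \<Rightarrow> 'a poly \<Rightarrow> nat \<Rightarrow> nat" where
  "sturm_deg f\<^sub>0 f\<^sub>1 i = degree (sturm_quot f\<^sub>0 f\<^sub>1 i)"

definition sturm_lc :: "'a::field poly \<Rightarrow> 'a poly \<Rightarrow> nat \<Rightarrow> 'a" where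
  "sturm_lc f\<^sub>0 f\<^sub>1 i = lead_coeff (sturm_quot f\<^sub>0 f\<^sub>1 i)"

text \<open>\<open>reflect_poly p\<close> is the reversal \<open>x^(deg p) p(1/x)\<close>.\<close>

definition sturm_series :: "'a::field poly \<Rightarrow> 'a poly \<Rightarrow> 'a fps" where
  "sturm_series f\<^sub>0 f\<^sub>1 =
     fps_X ^ (sturm_deg f\<^sub>0 f\<^sub>1 0 - 1) * fps_of_poly (reflect_poly f\<^sub>1)
       / fps_of_poly (reflect_poly f\<^sub>0)"

definition hankel_det :: "nat \<Rightarrow> 'a::comm_ring_1 fps \<Rightarrow> 'a" where
  "hankel_det n F = det (mat n n (\<lambda>(i, j). fps_nth F (i + j)))"

lemma hankel_det_0: "hankel_det 0 F = 1"
  by (simp add: hankel_det_def)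

lemma sturm_quot_eq:
  assumes "sturm f\<^sub>0 f\<^sub>1 (Suc i) \<noteq> 0"
  shows "sturm f\<^sub>0 f\<^sub>1 i
    = sturm_quot f\<^sub>0 f\<^sub>1 i * sturm f\<^sub>0 f\<^sub>1 (Suc i) - sturm f\<^sub>0 f\<^sub>1 (Suc (Suc i))"
  using assms by (simp add: sturm_quot_def)

lemma sturm_zero_mono:
  assumes "sturm f\<^sub>0 f\<^sub>1 (Suc i) = 0" "i \<le> j"
  shows "sturm f\<^sub>0 f\<^sub>1 (Suc j) = 0"
  using assms(2,1) by (induction j rule: dec_induct) simp_all

lemma sturm_degree_less:
  assumes "degree f\<^sub>1 < degree f\<^sub>0" "sturm f\<^sub>0 f\<^sub>1 (Suc i) \<noteq> 0"
  shows "degree (sturm f\<^sub>0 f\<^sub>1 (Suc i)) < degree (sturm f\<^sub>0 f\<^sub>1 i)"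
proof (cases i)
  case (Suc k)
  then show ?thesis
    using assms(2) degree_mod_less[of "sturm f\<^sub>0 f\<^sub>1 (Suc k)" "sturm f\<^sub>0 f\<^sub>1 k"]
    by (auto split: if_splits)
qed (use assms in simp)

lemma sturm_last_ex1:
  assumes "f\<^sub>0 \<noteq> 0" "degree f\<^sub>1 < degree f\<^sub>0"
  shows "\<exists>!s. sturm f\<^sub>0 f\<^sub>1 s \<noteq> 0 \<and> sturm f\<^sub>0 f\<^sub>1 (Suc s) = 0"
proof -
  let ?f = "sturm f\<^sub>0 f\<^sub>1"
  have "\<exists>n. ?f (Suc n) = 0"
  proof (rule ccontr)
    assume nz: "\<nexists>n. ?f (Suc n) = 0"
    have "degree (?f n) + n \<le> degree f\<^sub>0" for n
    proof (induction n)
      case (Suc n)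
      then show ?case using sturm_degree_less[OF assms(2), of n] nz by fastforce
    qed simp
    from this[of "Suc (degree f\<^sub>0)"] show False by simp
  qed
  then obtain n where n: "?f (Suc n) = 0" "\<forall>i<n. ?f (Suc i) \<noteq> 0"
    using exists_least_iff[of "\<lambda>n. ?f (Suc n) = 0"] by blast
  have "?f n \<noteq> 0" using n(2) assms(1) by (cases n) auto
  moreover have "s = n" if "?f s \<noteq> 0" "?f (Suc s) = 0" for s
  proof (rule antisym)
    show "n \<le> s" using n(2) that(2) by (meson not_le)
    show "s \<le> n"
    proof (rule ccontr)
      assume "\<not> s \<le> n"
      then obtain j where "s = Suc j" "n \<le> j" by (cases s) auto
      then show False using sturm_zero_mono[OF n(1)] that(1) by simp
    qed
  qed
  ultimately show ?thesis using n(1) by blast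
qed

end

theory Submission
  imports Defs
begin

text \<open>Put \<open>S\<^sub>k = S(f\<^sub>k, f\<^bsub>k+1\<^esub>)\<close> and let \<open>R\<^sub>k\<close> be the reversal of \<open>B\<^sub>k\<close>. Reversing
  \<open>f\<^sub>k = B\<^sub>k f\<^bsub>k+1\<^esub> - f\<^bsub>k+2\<^esub>\<close> gives the continued fraction step
  \<open>S\<^sub>k D = x^(m\<^sub>k - 1)\<close> with \<open>D = R\<^sub>k - x^(m\<^sub>k + 1) S\<^bsub>k+1\<^esub>\<close>. If \<open>F D = x^(m - 1)\<close>, the Hankel
  matrix of \<open>F\<close> has generating function \<open>(x F(x) - y F(y)) / (x - y)\<close>, and multiplying it by
  \<open>D(x) D(y)\<close>, a congruence by a triangular Toeplitz matrix, gives \<open>(x^m D(y) - y^m D(x)) / (x - y)\<close>.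
  The matrix of the latter is block diagonal, with an anti-triangular block of size \<open>m\<close> and the
  Hankel matrix of \<open>S\<^bsub>k+1\<^esub>\<close> as blocks, so \<open>H\<^sub>r(S\<^sub>k)\<close> reduces to \<open>H\<^bsub>r-m\<^esub>(S\<^bsub>k+1\<^esub>)\<close>.\<close>

section \<open>Anti-triangular determinants\<close>

lemma det_anti_triangular:
  fixes a :: "nat \<Rightarrow> nat \<Rightarrow> 'a::comm_ring_1"
  assumes "\<And>i j. i + j + 1 < n \<Longrightarrow> a i j = 0"
    and "\<And>i j. i + j + 1 = n \<Longrightarrow> a i j = b"
  shows "det (mat n n (\<lambda>(i, j). a i j)) = (-1) ^ (n * (n - 1) div 2) * b ^ n"
  using assms
proof (induction n arbitrary: a)
  case 0
  then show ?case by simp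
next
  case (Suc n)
  let ?A = "mat (Suc n) (Suc n) (\<lambda>(i, j). a i j)"
  have "det ?A = (\<Sum>j<Suc n. ?A $$ (0, j) * cofactor ?A 0 j)"
    by (rule laplace_expansion_row) simp_all
  also have "\<dots> = (\<Sum>j<Suc n. if j = n then b * cofactor ?A 0 n else 0)"
    using Suc.prems by (intro sum.cong) auto
  also have "\<dots> = b * cofactor ?A 0 n"
    by simp
  also have "cofactor ?A 0 n = (-1) ^ n * det (mat_delete ?A 0 n)"
    by (simp add: cofactor_def)
  \<comment> \<open>Without row 0 and the last column the matrix is again anti-triangular with the
    same \<open>b\<close>; the cofactor signs (-1)^n accumulate to the exponent n(n-1)/2.\<close>
  also have "mat_delete ?A 0 n = mat n n (\<lambda>(i, j). a (Suc i) j)"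
    by (rule eq_matI) (auto simp: mat_delete_def)
  also have "det \<dots> = (-1) ^ (n * (n - 1) div 2) * b ^ n"
    by (rule Suc.IH) (use Suc.prems in auto)
  also have "Suc n * (Suc n - 1) div 2 = n + n * (n - 1) div 2"
  proof -
    have "Suc n * (Suc n - 1) = 2 * n + n * (n - 1)"
      by (cases n) simp_all
    then show ?thesis by simp
  qed
  ultimately show ?case
    by (simp add: power_add mult_ac)
qed

section \<open>Toeplitz congruence of a Hankel matrix\<close>

definition toeplitz_mat :: "nat \<Rightarrow> 'a::zero fps \<Rightarrow> 'a mat" where
  "toeplitz_mat n D = mat n n (\<lambda>(i, k). if k \<le> i then fps_nth D (i - k) else 0)"

lemma det_toeplitz_mat:
  fixes D :: "'a::idom fps"
  shows "det (toeplitz_mat n D) = fps_nth D 0 ^ n"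
proof -
  have "det (toeplitz_mat n D) = prod_list (diag_mat (toeplitz_mat n D))"
    by (rule det_lower_triangular[of n]) (auto simp: toeplitz_mat_def)
  also have "diag_mat (toeplitz_mat n D) = replicate n (fps_nth D 0)"
    by (rule nth_equalityI) (simp_all add: diag_mat_def toeplitz_mat_def)
  finally show ?thesis by simp
qed

text \<open>The coefficient of x^i y^j in D(x) D(y) (x F(x) - y F(y)) / (x - y), since this quotient
  expands to the sum of all F_(k+l) x^k y^l.\<close>

definition hankel_conv :: "'a::comm_ring_1 fps \<Rightarrow> 'a fps \<Rightarrow> nat \<Rightarrow> nat \<Rightarrow> 'a" where
  "hankel_conv D F i j =
     (\<Sum>k\<le>i. \<Sum>l\<le>j. fps_nth D (i - k) * fps_nth D (j - l) * fps_nth F (k + l))"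

lemma hankel_conv_commute: "hankel_conv D F i j = hankel_conv D F j i"
  unfolding hankel_conv_def by (subst sum.swap) (simp add: ac_simps)

lemma fps_mult_nth_rev: "fps_nth (F * D) i = (\<Sum>k\<le>i. fps_nth D (i - k) * fps_nth F k)"
  for F :: "'a::comm_ring_1 fps"
  unfolding fps_mult_nth atLeast0AtMost by (intro sum.cong) (simp_all add: mult.commute)

text \<open>Splits off the term l = 0. The double sum left over is the same as in
  \<open>hankel_conv_Suc_left\<close>, so it cancels when the two are subtracted.\<close>

lemma hankel_conv_Suc_right:
  "hankel_conv D F i (Suc j) =
     fps_nth D (Suc j) * fps_nth (F * D) i +
     (\<Sum>k\<le>i. \<Sum>l\<le>j. fps_nth D (i - k) * fps_nth D (j - l) * fps_nth F (Suc (k + l)))"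
  unfolding hankel_conv_def fps_mult_nth_rev
  by (simp add: sum.atMost_Suc_shift sum.distrib sum_distrib_left ac_simps
      del: sum.atMost_Suc)

lemma hankel_conv_Suc_left:
  "hankel_conv D F (Suc i) j =
     fps_nth D (Suc i) * fps_nth (F * D) j +
     (\<Sum>k\<le>i. \<Sum>l\<le>j. fps_nth D (i - k) * fps_nth D (j - l) * fps_nth F (Suc (k + l)))"
  by (subst hankel_conv_commute, subst hankel_conv_Suc_right, subst sum.swap)
    (simp add: ac_simps)

lemma toeplitz_hankel_toeplitz:
  fixes D F :: "'a::comm_ring_1 fps"
  shows "toeplitz_mat n D * mat n n (\<lambda>(i, j). fps_nth F (i + j)) * transpose_mat (toeplitz_mat n D)
    = mat n n (\<lambda>(i, j). hankel_conv D F i j)"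
proof (rule eq_matI)
  fix i j
  assume "i < dim_row (mat n n (\<lambda>(i, j). hankel_conv D F i j))"
    "j < dim_col (mat n n (\<lambda>(i, j). hankel_conv D F i j))"
  then have ij: "i < n" "j < n" by simp_all
  \<comment> \<open>Pads the triangular sums with zeros up to \<open>n\<close>, the range over which
    matrix products sum.\<close>
  have cut: "(\<Sum>k<n. (if k \<le> i then f k else 0)) = (\<Sum>k\<le>i. f k)" if "i < n"
    for f :: "nat \<Rightarrow> 'a" and i
    using that by (intro sum.mono_neutral_cong_right) auto
  have "hankel_conv D F i j = (\<Sum>l\<le>j. (\<Sum>k\<le>i. fps_nth D (i - k) * fps_nth F (k + l)) * fps_nth D (j - l))"
    unfolding hankel_conv_def sum_distrib_right
    by (subst sum.swap) (intro sum.cong refl, simp add: mult.assoc mult.commute mult.left_commute)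
  also have "\<dots> = (\<Sum>l<n. if l \<le> j then (\<Sum>k\<le>i. fps_nth D (i - k) * fps_nth F (k + l)) * fps_nth D (j - l) else 0)"
    using ij by (simp add: cut)
  also have "\<dots> = (\<Sum>l<n. (\<Sum>k<n. (if k \<le> i then fps_nth D (i - k) * fps_nth F (k + l) else 0)) *
      (if l \<le> j then fps_nth D (j - l) else 0))"
    using ij by (intro sum.cong) (simp_all add: cut)
  finally show "(toeplitz_mat n D * mat n n (\<lambda>(i, j). fps_nth F (i + j)) * (toeplitz_mat n D)\<^sup>T) $$ (i, j)
      = mat n n (\<lambda>(i, j). hankel_conv D F i j) $$ (i, j)"
    using ij by (simp add: toeplitz_mat_def scalar_prod_def lessThan_atLeast0 if_distrib if_distribR
        cong: if_cong)
qed (simp_all add: toeplitz_mat_def)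

lemma hankel_det_hankel_conv:
  fixes D F :: "'a::idom fps"
  shows "fps_nth D 0 ^ (2 * n) * hankel_det n F = det (mat n n (\<lambda>(i, j). hankel_conv D F i j))"
proof -
  have T: "toeplitz_mat n D \<in> carrier_mat n n"
    by (simp add: toeplitz_mat_def)
  show ?thesis
    unfolding toeplitz_hankel_toeplitz[symmetric] hankel_det_def
    using T by (simp add: det_mult[of _ n] det_transpose[of _ n] det_toeplitz_mat power_add mult_2)
qed

text \<open>Multiplying by x - y relates the entries (i+1, j) and (i, j+1), so row 0 determines all
  rows along anti-diagonals. As F D = x^(m-1), a correction arises only for i = m-1 or j = m-1, the
  border between the blocks.\<close>

lemma hankel_conv_X_power:
  fixes D F :: "'a::comm_ring_1 fps"
  assumes "m > 0" "F * D = fps_X ^ (m - 1)"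
  shows "hankel_conv D F i j =
    (if i < m \<and> j < m \<and> m \<le> i + j + 1 then fps_nth D (i + j + 1 - m)
     else if m \<le> i \<and> m \<le> j then - fps_nth D (i + j + 1 - m) else 0)"
proof (induction i arbitrary: j)
  case 0
  have "hankel_conv D F 0 j = fps_nth D 0 * fps_nth (F * D) j"
    by (simp add: hankel_conv_def fps_mult_nth_rev sum_distrib_left mult.assoc)
  then show ?case
    using assms by auto
next
  case (Suc i)
  have "hankel_conv D F (Suc i) j = hankel_conv D F i (Suc j)
      + fps_nth D (Suc i) * fps_nth (F * D) j - fps_nth D (Suc j) * fps_nth (F * D) i"
    by (simp add: hankel_conv_Suc_left hankel_conv_Suc_right)
  then show ?case
    unfolding Suc.IH assms(2) using assms(1) by auto
qed

section \<open>Hankel determinants under one continued fraction step\<close>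

lemma hankel_det_continued_fraction_step:
  fixes F G P :: "'a::field fps"
  assumes m: "m > 0" and FD: "F * (P - fps_X ^ (m + 1) * G) = fps_X ^ (m - 1)"
    and P: "\<And>k. k > m \<Longrightarrow> fps_nth P k = 0" "fps_nth P 0 \<noteq> 0"
    and n: "m \<le> n"
  shows "hankel_det n F =
    (-1) ^ (m * (m - 1) div 2) / fps_nth P 0 ^ (2 * n - m) * hankel_det (n - m) G"
proof -
  define D where "D = P - fps_X ^ (m + 1) * G"
  have D0: "fps_nth D 0 = fps_nth P 0"
    by (simp add: D_def)
  \<comment> \<open>\<open>P\<close> stops at x^m, so from x^(m+1) on \<open>D\<close> agrees with
    the shifted \<open>- G\<close>. The lower block starts exactly there: at i = j = m its index i +
    j + 1 - m is m + 1.\<close>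
  have Dhigh: "- fps_nth D (m + 1 + k) = fps_nth G k" for k
    using P(1)[of "m + 1 + k"] by (simp add: D_def fps_X_power_mult_nth del: power_Suc)
  define A where "A = mat m m (\<lambda>(i, j). if m \<le> i + j + 1 then fps_nth D (i + j + 1 - m) else 0)"
  define H where "H = mat (n - m) (n - m) (\<lambda>(i, j). fps_nth G (i + j))"
  have conv: "hankel_conv D F i j =
    (if i < m \<and> j < m \<and> m \<le> i + j + 1 then fps_nth D (i + j + 1 - m)
     else if m \<le> i \<and> m \<le> j then - fps_nth D (i + j + 1 - m) else 0)" for i j
    using hankel_conv_X_power[OF m] FD unfolding D_def by blast
  have lower: "hankel_conv D F i j = fps_nth G (i - m + (j - m))" if "m \<le> i" "m \<le> j" for i j
  proof -
    have "i + j + 1 - m = m + 1 + (i - m + (j - m))"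
      using that by simp
    with that show ?thesis by (simp only: conv Dhigh) simp
  qed
  have "mat n n (\<lambda>(i, j). hankel_conv D F i j) = four_block_mat A (0\<^sub>m m (n - m)) (0\<^sub>m (n - m) m) H"
    using n by (intro eq_matI) (auto simp: A_def H_def lower, auto simp: conv)
  then have "det (mat n n (\<lambda>(i, j). hankel_conv D F i j)) = det A * det H"
    using det_four_block_mat_upper_right_zero[of A m "0\<^sub>m m (n - m)" "n - m" "0\<^sub>m (n - m) m" H]
    by (simp add: A_def H_def)
  \<comment> \<open>The anti-diagonal i + j + 1 = m carries the constant term of \<open>D\<close>;
    the coefficients below it do not affect the determinant.\<close>
  also have "det A = (-1) ^ (m * (m - 1) div 2) * fps_nth P 0 ^ m"
    unfolding A_def by (rule det_anti_triangular) (auto simp: D0)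
  finally have "fps_nth P 0 ^ (2 * n) * hankel_det n F =
      (-1) ^ (m * (m - 1) div 2) * fps_nth P 0 ^ m * hankel_det (n - m) G"
    unfolding hankel_det_hankel_conv[symmetric] D0 by (simp add: H_def hankel_det_def)
  moreover have "fps_nth P 0 ^ (2 * n) = fps_nth P 0 ^ (2 * n - m) * fps_nth P 0 ^ m"
    using n by (simp flip: power_add)
  ultimately show ?thesis
    using P(2) by (simp add: field_simps)
qed

text \<open>Row 0 of \<open>hankel_conv D F\<close> vanishes except in column \<open>m - 1\<close>,
  and a matrix of order \<open>n < m\<close> stops short of that column.\<close>

lemma hankel_det_eq_0_of_X_power:
  fixes F D :: "'a::field fps"
  assumes FD: "F * D = fps_X ^ (m - 1)" and D0: "fps_nth D 0 \<noteq> 0" and n: "0 < n" "n < m"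
  shows "hankel_det n F = 0"
proof -
  let ?M = "mat n n (\<lambda>(i, j). hankel_conv D F i j)"
  have "?M $$ (0, j) = 0" if "j < n" for j
    using that n by (simp add: hankel_conv_X_power[OF _ FD])
  then have "det ?M = 0"
    using n(1) by (simp add: laplace_expansion_row[of _ n 0] del: index_mat)
  then show ?thesis
    using D0 by (simp flip: hankel_det_hankel_conv)
qed

lemma hankel_det_fps_zero: "n > 0 \<Longrightarrow> hankel_det n (0 :: 'a::comm_ring_1 fps) = 0"
  by (simp add: hankel_det_def laplace_expansion_row[of _ n 0])

section \<open>Reversal and the continued fraction of the Sturm series\<close>

lemma reflect_poly_diff:
  fixes p q :: "'a::comm_ring_1 poly"
  assumes "degree q < degree p"
  shows "reflect_poly (p - q) = reflect_poly p - monom 1 (degree p - degree q) * reflect_poly q"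
proof -
  have "degree (p - q) = degree p"
    using degree_add_eq_left[of "- q" p] assms by simp
  then show ?thesis
    using assms by (intro poly_eqI) (auto simp: coeff_reflect_poly coeff_monom_mult coeff_eq_0)
qed

lemma degree_div_poly:
  fixes p q :: "'a::field poly"
  assumes "q \<noteq> 0" "degree q < degree p"
  shows "degree (p div q) + degree q = degree p"
proof -
  have "p div q \<noteq> 0"
    using assms by (auto simp: div_poly_eq_0_iff)
  moreover have "degree (p div q * q) = degree p"
    using assms degree_mod_less[of q p] degree_add_eq_left[of "- (p mod q)" p]
    by (cases "p mod q = 0") (simp_all flip: minus_mod_eq_div_mult)
  ultimately show ?thesis
    using assms(1) by (simp add: degree_mult_eq)
qed

lemma sturm_series_mult_reflect:
  fixes f g :: "'a::field poly"
  assumes "f \<noteq> 0"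
  shows "sturm_series f g * fps_of_poly (reflect_poly f)
    = fps_X ^ (degree (f div g) - 1) * fps_of_poly (reflect_poly g)"
  unfolding sturm_series_def sturm_deg_def sturm_quot_def
  \<comment> \<open>The constant term of the reversal of \<open>f\<close> is the leading coefficient
    of \<open>f\<close>, hence the denominator is a unit.\<close>
  using assms by (simp add: fps_divide_unit mult.assoc inverse_mult_eq_1)

text \<open>Multiplying the bracket by the reversal of \<open>g\<close> clears its denominator and
  yields the reversal of \<open>f\<close>; afterwards the reversal of \<open>g\<close>, being
  nonzero, cancels. A zero remainder is allowed: the inner series is then 0 and the continued
  fraction ends.\<close>

lemma sturm_series_step:
  fixes f g :: "'a::field poly"
  assumes g: "g \<noteq> 0" and deg: "degree g < degree f"
  defines "m \<equiv> degree (f div g)"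
  shows "sturm_series f g *
      (fps_of_poly (reflect_poly (f div g)) - fps_X ^ (m + 1) * sturm_series g (- (f mod g)))
    = fps_X ^ (m - 1)"
proof -
  define h where "h = - (f mod g)"
  have mdeg: "m + degree g = degree f"
    unfolding m_def by (rule degree_div_poly[OF g deg])
  have f: "f = f div g * g - h"
    by (simp add: h_def)
  have h: "h = 0 \<or> degree h < degree g"
    using degree_mod_less[OF g, of f] by (auto simp: h_def)
  have degB: "degree (f div g * g) = degree f"
    using g deg mdeg by (subst degree_mult_eq) (auto simp: m_def div_poly_eq_0_iff)
  have "fps_X ^ (m + 1) * sturm_series g h * fps_of_poly (reflect_poly g)
      = fps_X ^ (degree f - degree h) * fps_of_poly (reflect_poly h)"
  proof (cases "h = 0")
    case True
    then show ?thesis by (simp add: sturm_series_def)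
  next
    case False
    with h have "degree h < degree g" by simp
    with degree_div_poly[OF False this] mdeg
    \<comment> \<open>The shift x^(m+1), combined with the power inside
      \<open>sturm_series g h\<close>, is exactly the gap in degree that reversing f = B g - h gives
      to \<open>h\<close>.\<close>
    have "m + 1 + (degree (g div h) - 1) = degree f - degree h" by simp
    then show ?thesis
      by (simp only: mult.assoc sturm_series_mult_reflect[OF g]) (simp only: mult.assoc[symmetric] power_add[symmetric])
  qed
  moreover have "degree h < degree (f div g * g)"
    using h deg degB by auto
  then have "reflect_poly f = reflect_poly (f div g) * reflect_poly g
      - monom 1 (degree f - degree h) * reflect_poly h"
    using reflect_poly_diff[of h "f div g * g"] degB f by (simp add: reflect_poly_mult)
  ultimately have D: "(fps_of_poly (reflect_poly (f div g)) - fps_X ^ (m + 1) * sturm_series g h)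
      * fps_of_poly (reflect_poly g) = fps_of_poly (reflect_poly f)"
    by (simp add: left_diff_distrib fps_of_poly_diff fps_of_poly_mult fps_of_poly_monom')
  have "sturm_series f g *
      (fps_of_poly (reflect_poly (f div g)) - fps_X ^ (m + 1) * sturm_series g h)
      * fps_of_poly (reflect_poly g) = fps_X ^ (m - 1) * fps_of_poly (reflect_poly g)"
    unfolding mult.assoc D unfolding m_def using deg by (intro sturm_series_mult_reflect) auto
  then show ?thesis
    using g unfolding h_def by (metis fps_of_poly_0 fps_of_poly_eq_iff mult_right_cancel reflect_poly_eq_0_iff)
qed

section \<open>Iteration along the Sturm sequence\<close>

lemma sturm_nonzero:
  assumes "f\<^sub>0 \<noteq> 0" "degree f\<^sub>1 < degree f\<^sub>0" "k \<le> sturm_last f\<^sub>0 f\<^sub>1"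
  shows "sturm f\<^sub>0 f\<^sub>1 k \<noteq> 0"
proof -
  have last: "sturm f\<^sub>0 f\<^sub>1 (sturm_last f\<^sub>0 f\<^sub>1) \<noteq> 0"
    using theI'[OF sturm_last_ex1[OF assms(1,2)]] unfolding sturm_last_def by blast
  show ?thesis
  proof (cases k)
    case (Suc i)
    then obtain j where "sturm_last f\<^sub>0 f\<^sub>1 = Suc j" "i \<le> j"
      using assms(3) by (cases "sturm_last f\<^sub>0 f\<^sub>1") auto
    with last Suc sturm_zero_mono show ?thesis by metis
  qed (use assms in simp)
qed

lemma sturm_after_last:
  assumes "f\<^sub>0 \<noteq> 0" "degree f\<^sub>1 < degree f\<^sub>0"
  shows "sturm f\<^sub>0 f\<^sub>1 (Suc (sturm_last f\<^sub>0 f\<^sub>1)) = 0"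
  using theI'[OF sturm_last_ex1[OF assms]] unfolding sturm_last_def by blast

lemma hankel_det_sturm_step:
  fixes f\<^sub>0 f\<^sub>1 :: "'a::field poly"
  assumes f: "f\<^sub>0 \<noteq> 0" "degree f\<^sub>1 < degree f\<^sub>0" and k: "k < sturm_last f\<^sub>0 f\<^sub>1"
  defines "S \<equiv> \<lambda>k. sturm_series (sturm f\<^sub>0 f\<^sub>1 k) (sturm f\<^sub>0 f\<^sub>1 (Suc k))"
    and "m \<equiv> sturm_deg f\<^sub>0 f\<^sub>1 k"
    and "b \<equiv> sturm_lc f\<^sub>0 f\<^sub>1 k"
  shows "m \<le> n \<Longrightarrow> hankel_det n (S k) =
      (-1) ^ (m * (m - 1) div 2) / b ^ (2 * n - m) * hankel_det (n - m) (S (Suc k))"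
    and "0 < n \<Longrightarrow> n < m \<Longrightarrow> hankel_det n (S k) = 0"
proof -
  let ?f = "sturm f\<^sub>0 f\<^sub>1 k" and ?g = "sturm f\<^sub>0 f\<^sub>1 (Suc k)"
  let ?P = "fps_of_poly (reflect_poly (?f div ?g))"
  have g: "?g \<noteq> 0"
    using k by (intro sturm_nonzero f) auto
  have deg: "degree ?g < degree ?f"
    by (rule sturm_degree_less[OF f(2) g])
  have m: "m = degree (?f div ?g)"
    by (simp add: m_def sturm_deg_def sturm_quot_def)
  have "m > 0"
    using degree_div_poly[OF g deg] deg m by simp
  have b: "fps_nth ?P 0 = b"
    by (simp add: b_def sturm_lc_def sturm_quot_def)
  have b0: "fps_nth ?P 0 \<noteq> 0"
    using \<open>m > 0\<close> m by auto
  have P: "fps_nth ?P i = 0" if "i > m" for i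
    using that by (simp add: coeff_reflect_poly m)
  \<comment> \<open>As \<open>?g\<close> is nonzero, the test in \<open>sturm\<close> fails and the
    next entry is the genuine negated remainder.\<close>
  have step: "S k * (?P - fps_X ^ (m + 1) * S (Suc k)) = fps_X ^ (m - 1)"
    using sturm_series_step[OF g deg] g by (simp add: S_def m)
  show "hankel_det n (S k) =
      (-1) ^ (m * (m - 1) div 2) / b ^ (2 * n - m) * hankel_det (n - m) (S (Suc k))" if "m \<le> n"
    using hankel_det_continued_fraction_step[OF \<open>m > 0\<close> step P b0 that] unfolding b .
  show "hankel_det n (S k) = 0" if "0 < n" "n < m"
    using hankel_det_eq_0_of_X_power[OF step _ that] b0 by simp
qed

text \<open>The step at index i acts on a determinant of order r - (m_0 + ... + m_(i-1)), which
  explains the exponent of b_i.\<close>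

lemma hankel_det_sturm_iterate:
  fixes f\<^sub>0 f\<^sub>1 :: "'a::field poly"
  assumes f: "f\<^sub>0 \<noteq> 0" "degree f\<^sub>1 < degree f\<^sub>0"
  defines "S \<equiv> \<lambda>k. sturm_series (sturm f\<^sub>0 f\<^sub>1 k) (sturm f\<^sub>0 f\<^sub>1 (Suc k))"
    and "m \<equiv> sturm_deg f\<^sub>0 f\<^sub>1"
    and "b \<equiv> sturm_lc f\<^sub>0 f\<^sub>1"
  assumes "k \<le> sturm_last f\<^sub>0 f\<^sub>1" "(\<Sum>i<k. m i) \<le> r"
  shows "hankel_det r (sturm_series f\<^sub>0 f\<^sub>1) =
    (-1) ^ (\<Sum>i<k. m i * (m i - 1) div 2) / (\<Prod>i<k. b i ^ (2 * (r - (\<Sum>j<i. m j)) - m i))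
      * hankel_det (r - (\<Sum>i<k. m i)) (S k)"
  using assms(6,7)
proof (induction k)
  case 0
  then show ?case by (simp add: S_def)
next
  case (Suc k)
  have "hankel_det (r - (\<Sum>i<k. m i)) (S k) =
    (-1) ^ (m k * (m k - 1) div 2) / b k ^ (2 * (r - (\<Sum>i<k. m i)) - m k)
      * hankel_det (r - (\<Sum>i<Suc k. m i)) (S (Suc k))"
    using hankel_det_sturm_step(1)[OF f, of k "r - (\<Sum>i<k. m i)"] Suc.prems
    unfolding S_def m_def b_def by simp
  with Suc show ?case by (simp add: power_add)
qed

theorem theorem2p3:
  fixes f\<^sub>0 f\<^sub>1 :: "complex poly" and r :: nat
  defines "s \<equiv> sturm_last f\<^sub>0 f\<^sub>1"
    and "m \<equiv> sturm_deg f\<^sub>0 f\<^sub>1"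
    and "b \<equiv> sturm_lc f\<^sub>0 f\<^sub>1"
  assumes "f\<^sub>0 \<noteq> 0" and "f\<^sub>1 \<noteq> 0" and "degree f\<^sub>0 > degree f\<^sub>1" and "r > 0"
  shows "(\<forall>\<kappa>\<in>{1..s}. r = (\<Sum>i<\<kappa>. m i) \<longrightarrow>
            hankel_det r (sturm_series f\<^sub>0 f\<^sub>1) =
              (-1) ^ (\<Sum>i<\<kappa>. m i * (m i - 1) div 2) *
              (1 / ((\<Prod>i<\<kappa> - 1. b i ^ (2 * (r - (\<Sum>j<i. m j)) - m i))
                     * b (\<kappa> - 1) ^ m (\<kappa> - 1))))
       \<and> ((\<nexists>\<kappa>. \<kappa> \<in> {1..s} \<and> r = (\<Sum>i<\<kappa>. m i)) \<longrightarrow>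
            hankel_det r (sturm_series f\<^sub>0 f\<^sub>1) = 0)"
proof (intro conjI ballI impI)
  note f = \<open>f\<^sub>0 \<noteq> 0\<close> \<open>degree f\<^sub>1 < degree f\<^sub>0\<close>
  note iterate = hankel_det_sturm_iterate[OF f, folded s_def m_def b_def]
  {
    fix \<kappa>
    assume \<kappa>: "\<kappa> \<in> {1..s}" and r: "r = (\<Sum>i<\<kappa>. m i)"
    obtain k where k: "\<kappa> = Suc k"
      using \<kappa> by (cases \<kappa>) auto
    \<comment> \<open>At the last step the remaining order is exactly \<open>m k\<close>, so its
      exponent 2 m_k - m_k collapses to m_k, and a determinant of order 0 is left.\<close>
    have "2 * (r - (\<Sum>j<k. m j)) - m k = m k"
      using r k by simp
    then show "hankel_det r (sturm_series f\<^sub>0 f\<^sub>1) =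
              (-1) ^ (\<Sum>i<\<kappa>. m i * (m i - 1) div 2) *
              (1 / ((\<Prod>i<\<kappa> - 1. b i ^ (2 * (r - (\<Sum>j<i. m j)) - m i))
                     * b (\<kappa> - 1) ^ m (\<kappa> - 1)))"
      using iterate[of \<kappa> r] \<kappa> r[symmetric] unfolding k by (simp add: hankel_det_0)
  }
  assume no: "\<nexists>\<kappa>. \<kappa> \<in> {1..s} \<and> r = (\<Sum>i<\<kappa>. m i)"
  have ne: "r \<noteq> (\<Sum>i<k. m i)" if "k \<le> s" for k
    using no that \<open>r > 0\<close> by (cases k) force+
  \<comment> \<open>As many whole blocks as fit into \<open>r\<close> are removed. What remains has
    positive order, so its determinant vanishes: either the sequence is exhausted and the series is
    0, or the order is less than the next block size \<open>m k\<close>.\<close>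
  define k where "k = (GREATEST k. k \<le> s \<and> (\<Sum>i<k. m i) \<le> r)"
  have k: "k \<le> s \<and> (\<Sum>i<k. m i) \<le> r"
    unfolding k_def by (rule GreatestI_nat[of _ 0 s]) auto
  have kmax: "j \<le> k" if "j \<le> s" "(\<Sum>i<j. m i) \<le> r" for j
    unfolding k_def by (rule Greatest_le_nat[of _ _ s]) (use that in auto)
  have pos: "0 < r - (\<Sum>i<k. m i)"
    using k ne[of k] by simp
  have "hankel_det (r - (\<Sum>i<k. m i)) (sturm_series (sturm f\<^sub>0 f\<^sub>1 k) (sturm f\<^sub>0 f\<^sub>1 (Suc k))) = 0"
  proof (cases "k = s")
    case True
    then have "sturm_series (sturm f\<^sub>0 f\<^sub>1 k) (sturm f\<^sub>0 f\<^sub>1 (Suc k)) = 0"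
      using sturm_after_last[OF f] by (simp add: s_def sturm_series_def del: sturm.simps)
    then show ?thesis
      using hankel_det_fps_zero[OF pos] by simp
  next
    case False
    then have "k < s" using k by simp
    moreover have "r - (\<Sum>i<k. m i) < m k"
      using kmax[of "Suc k"] \<open>k < s\<close> pos by force
    ultimately show ?thesis
      using hankel_det_sturm_step(2)[OF f] pos unfolding s_def m_def by blast
  qed
  then show "hankel_det r (sturm_series f\<^sub>0 f\<^sub>1) = 0"
    using iterate[of k r] k by simp
qed

end
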